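(* For every integer $n\ge 2$, \[ \sum_{i=1}^{n}(q^{i-1}+q^{i}+q^{i+1})\,[i]_q^3\;+\;\sum_{i=1}^{n}\big(q^{i-1}[i-1]_q+q^{i}\big)\,[i]_q^2\;=\;[n+1]_q^2\,[n]_q^2 . \]
   Context: For a non-negative integer $k$, $[k]_q=(1-q^k)/(1-q)=1+q+\cdots+q^{k-1}$ (so $[0]_q=0$); the identity is an identity of polynomials in $q$. *)

theory Defs
  imports "HOL-Computational_Algebra.Polynomial"
begin

definition q :: "int poly" where
  "q = [:0, 1:]"

definition q_int :: "nat \<Rightarrow> int poly"  ("[_]\<^sub>q") where
  "[k]\<^sub>q = (\<Sum>j<k. q ^ j)"

lemma q_int_0: "[0]\<^sub>q = 0"
  by (simp add: q_int_def)

lemma one_minus_q_times_q_int: "(1 - q) * [k]\<^sub>q = 1 - q ^ k"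
  by (simp add: q_int_def one_diff_power_eq)

(* The division below is exact, so this is the usual quotient form of the q-integer. *)
lemma q_int_eq_quotient: "[k]\<^sub>q = (1 - q ^ k) div (1 - q)"
proof -
  have "1 - q \<noteq> 0"
    by (simp add: q_def one_pCons)
  then show ?thesis
    by (simp flip: one_minus_q_times_q_int)
qed

end

theory Submission
  imports Defs
begin

text \<open>The sum telescopes. Merged into one sum, the terms at index i equal the increment from i
  - 1 to i of the function sending k to the product of the squares of the q-integers of k + 1 and k
  (\<open>q_int_sum_step\<close>), and this function vanishes at 0.\<close>

lemma q_power_eq: "q ^ k = 1 + (q - 1) * [k]\<^sub>q"
  using one_minus_q_times_q_int[of k] by (simp add: algebra_simps)

lemma q_int_Suc: "[Suc k]\<^sub>q = 1 + q * [k]\<^sub>q"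
  by (simp add: q_int_def sum.lessThan_Suc_shift sum_distrib_left del: sum.lessThan_Suc)

text \<open>With x the q-integer of k, \<open>q_power_eq\<close> and \<open>q_int_Suc\<close> turn
  every power of q and every q-integer here into a polynomial in q and x. No symbolic exponent
  remains, so a ring identity in two indeterminates is left.\<close>

lemma q_int_sum_step:
  "(q ^ k + q ^ Suc k + q ^ Suc (Suc k)) * [Suc k]\<^sub>q ^ 3
     + (q ^ k * [k]\<^sub>q + q ^ Suc k) * [Suc k]\<^sub>q ^ 2
   = [Suc (Suc k)]\<^sub>q ^ 2 * [Suc k]\<^sub>q ^ 2 - [Suc k]\<^sub>q ^ 2 * [k]\<^sub>q ^ 2"
  unfolding power_Suc[of q] q_power_eq[of k] q_int_Suc by algebra

theorem theorem12:
  fixes n :: nat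
  assumes "n \<ge> 2"
  shows "(\<Sum>i=1..n. (q ^ (i - 1) + q ^ i + q ^ (i + 1)) * [i]\<^sub>q ^ 3)
       + (\<Sum>i=1..n. (q ^ (i - 1) * [i - 1]\<^sub>q + q ^ i) * [i]\<^sub>q ^ 2)
       = [n + 1]\<^sub>q ^ 2 * [n]\<^sub>q ^ 2"
proof -
  define f where "f k = [Suc k]\<^sub>q ^ 2 * [k]\<^sub>q ^ 2" for k
  have "(\<Sum>i=1..n. (q ^ (i - 1) + q ^ i + q ^ (i + 1)) * [i]\<^sub>q ^ 3)
       + (\<Sum>i=1..n. (q ^ (i - 1) * [i - 1]\<^sub>q + q ^ i) * [i]\<^sub>q ^ 2)
       = (\<Sum>k<n. (q ^ k + q ^ Suc k + q ^ Suc (Suc k)) * [Suc k]\<^sub>q ^ 3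
           + (q ^ k * [k]\<^sub>q + q ^ Suc k) * [Suc k]\<^sub>q ^ 2)"
    \<comment> \<open>The shift i = k + 1 removes the truncated subtraction i - 1.\<close>
    by (simp add: sum.atLeast1_atMost_eq sum.distrib)
  also have "\<dots> = (\<Sum>k<n. f (Suc k) - f k)"
    unfolding q_int_sum_step f_def ..
  also have "\<dots> = f n"
    \<comment> \<open>The boundary term \<open>f 0\<close> vanishes because it contains the factor
      \<open>[0]\<^sub>q\<close>.\<close>
    unfolding sum_lessThan_telescope by (simp add: f_def q_int_0)
  finally show ?thesis
    by (simp add: f_def)
qed

end
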